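(* Fix a parameter value $\theta$ and a point $y=(x,r^p,r^m,\lambda^p,\lambda^m)$, and let $f(\theta,y)$ be the Lagrangian of the singular Kalman smoothing problem defined in the context, with second derivative in $y$ $$ f_{yy}(\theta, y)= \begin{bmatrix} 0 & 0 & 0 & G(\theta)^\top & H(\theta)^\top \\ 0 & \ell_{rr}^p(r^p) & 0 & -Q^{\top/2} & 0 \\ 0 & 0 & \ell_{rr}^m(r^m) & 0 & -R^{\top/2} \\ G(\theta) & -Q^{1/2} & 0 & 0 & 0 \\ H(\theta) & 0 & -R^{1/2} & 0 & 0 \end{bmatrix}. $$ (1) Suppose that the Hessians $\ell^p_{rr}(r^p)$ and $\ell^m_{rr}(r^m)$ are invertible. Then $f_{yy}(\theta,y)$ is invertible if and only if the matrix $$ S := H(\theta)G(\theta)^{-1}Q^{1/2} (\ell_{rr}^p(r^p))^{-1}Q^{\top/2}G(\theta)^{-\top}H(\theta)^\top + R^{1/2} (\ell_{rr}^m(r^m))^{-1}R^{\top/2} $$ is invertible. (2) Suppose that each of $\ell^p,\ell^m$ is the least squares penalty or the Hybrid penalty. Then $S$ is invertible if and only if $$ \mathcal{N}(R) \cap \mathcal{N}\big(Q\,G(\theta)^{-\top}H(\theta)^\top\big) = \{0\}, $$ where $\mathcal{N}(\cdot)$ denotes the null space of a matrix.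
   Context: Setting (singular Kalman smoothing). Consider a linear state space model with time steps $k=1,\dots,N$, states $x_k = G_k(\theta)x_{k-1}+\epsilon^p_k$ and observations $z_k = H_k(\theta)x_k+\epsilon^m_k$, where $x_0$ is a given initial state estimate, $\theta$ is a vector of model parameters, $G_k(\theta),H_k(\theta)$ are real matrices of compatible sizes depending in a $\mathcal{C}^2$ way on $\theta$, and the errors $\epsilon_k^p,\epsilon_k^m$ have symmetric positive semidefinite (possibly singular) covariance matrices $Q_k$, $R_k$. Stacked notation: $x=[x_1;\dots;x_N]$, $z=[z_1;\dots;z_N]$, $\zeta=[x_0;0;\dots;0]$; $Q=\mathrm{diag}(Q_1,\dots,Q_N)$, $R=\mathrm{diag}(R_1,\dots,R_N)$ and $H(\theta)=\mathrm{diag}(H_1(\theta),\dots,H_N(\theta))$ are block diagonal. $G(\theta)$ is the square block lower bidiagonal matrix with identity blocks on the diagonal and blocks $-G_2(\theta),\dots,-G_N(\theta)$ on the first block subdiagonal (all other blocks zero); in particular $G(\theta)$ is invertible. $Q^{1/2}$ and $R^{1/2}$ are square matrices with $Q^{1/2}Q^{\top/2}=Q$ and $R^{1/2}R^{\top/2}=R$, where $Q^{\top/2}:=(Q^{1/2})^\top$ and $R^{\top/2}:=(R^{1/2})^\top$; also $G(\theta)^{-\top}:=(G(\theta)^{-1})^\top$. The losses $\ell^p,\ell^m$ are $\mathcal{C}^2$ real-valued functions of the stacked vectors $r^p$ (same dimension as $x$) and $r^m$ (same dimension as $z$); $\ell^p_{rr}(r^p)$ and $\ell^m_{rr}(r^m)$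 denote their Hessian matrices at $r^p$ and $r^m$. The singular smoothing problem is to minimize $\ell^p(r^p)+\ell^m(r^m)$ subject to $Q^{1/2}r^p=G(\theta)x-\zeta$ and $R^{1/2}r^m=H(\theta)x-z$. Its Lagrangian, with dual variables $\lambda^p,\lambda^m$ and $y=(x,r^p,r^m,\lambda^p,\lambda^m)$, is $$f(\theta,y)=\ell^p(r^p)+\ell^m(r^m)-\langle\lambda^p,\,Q^{1/2}r^p-G(\theta)x+\zeta\rangle-\langle\lambda^m,\,R^{1/2}r^m-H(\theta)x+z\rangle.$$ Penalties: the least squares penalty is $\ell(r)=\tfrac12\|r\|^2$ (Euclidean norm); the Hybrid penalty with parameter $\nu>0$ is $\ell(r;\nu)=\sum_i\big(\sqrt{r_i^2+\nu^2}-\nu\big)$. *)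

theory Defs
  imports "HOL-Analysis.Analysis" "Jordan_Normal_Form.Matrix"
begin

text \<open>
  Stacked vectors and matrices, whose total size is fixed, live in the types \<open>real^'n\<close> and
  \<open>real^'n^'m\<close>.  The blocks belonging to the individual time steps have sizes that may vary
  with the step; they are carrier-based vectors and matrices.  Infix \<open>$\<close> and \<open>\<bullet>\<close> keep
  their meaning for Euclidean spaces.
\<close>

no_notation Matrix.vec_index (infixl \<open>$\<close> 100)
no_notation Matrix.scalar_prod (infix \<open>\<bullet>\<close> 70)
hide_const (open) Matrix.mat Matrix.vec Matrix.row Matrix.col Matrix.rows Matrix.cols
hide_type (open) Matrix.vec Matrix.mat


section \<open>Stacking blocks\<close>

text \<open>
  \<open>block_index N d ix\<close> says that \<open>ix\<close> labels the coordinates of \<open>real^'n\<close> by pairs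
  (time step \<open>k \<in> {1..N}\<close>, position \<open>i < d k\<close> inside block \<open>k\<close>), so that \<open>real^'n\<close>
  consists of the stacked vectors with blocks of sizes \<open>d 1, \<dots>, d N\<close>.
\<close>

definition block_index :: "nat \<Rightarrow> (nat \<Rightarrow> nat) \<Rightarrow> ('n::finite \<Rightarrow> nat \<times> nat) \<Rightarrow> bool" where
  "block_index N d ix \<longleftrightarrow> bij_betw ix UNIV (SIGMA k:{1..N}. {..<d k})"

definition stack_vec :: "('n::finite \<Rightarrow> nat \<times> nat) \<Rightarrow> (nat \<Rightarrow> real Matrix.vec) \<Rightarrow> real^'n" where
  "stack_vec ix v = (\<chi> a. case ix a of (k, i) \<Rightarrow> vec_index (v k) i)"

definition stack_mat ::
  "('r::finite \<Rightarrow> nat \<times> nat) \<Rightarrow> ('c::finite \<Rightarrow> nat \<times> nat) \<Rightarrow> (nat \<Rightarrow> nat \<Rightarrow> real Matrix.mat)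
     \<Rightarrow> real^'c^'r" where
  "stack_mat ir ic B = (\<chi> a b. case (ir a, ic b) of ((k, i), (l, j)) \<Rightarrow> B k l $$ (i, j))"

definition block_diag ::
  "('r::finite \<Rightarrow> nat \<times> nat) \<Rightarrow> ('c::finite \<Rightarrow> nat \<times> nat) \<Rightarrow> (nat \<Rightarrow> real Matrix.mat) \<Rightarrow> real^'c^'r"
  where
  "block_diag ir ic D =
     stack_mat ir ic (\<lambda>k l. if k = l then D k else 0\<^sub>m (dim_row (D k)) (dim_col (D l)))"

definition block_bidiag ::
  "('n::finite \<Rightarrow> nat \<times> nat) \<Rightarrow> (nat \<Rightarrow> nat) \<Rightarrow> (nat \<Rightarrow> real Matrix.mat) \<Rightarrow> real^'n^'n" where
  "block_bidiag ix n G =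
     stack_mat ix ix (\<lambda>k l. if k = l then 1\<^sub>m (n k)
                            else if k = Suc l then - G k
                            else 0\<^sub>m (n k) (n l))"

definition sym_psd :: "nat \<Rightarrow> real Matrix.mat \<Rightarrow> bool" where
  "sym_psd d A \<longleftrightarrow> A \<in> carrier_mat d d \<and> transpose_mat A = A \<and>
     (\<forall>v\<in>carrier_vec d. 0 \<le> scalar_prod v (A *\<^sub>v v))"

text \<open>
  Concatenation of Cartesian vectors, the corresponding projections, and juxtaposition of matrices.
  As a matrix is the vector of its rows, \<open>A @- B\<close> also puts the matrix \<open>A\<close> above \<open>B\<close>.
\<close>

definition vcat :: "'a^'m::finite \<Rightarrow> 'a^'n::finite \<Rightarrow> 'a^('m + 'n)"  (infixr \<open>@-\<close> 61) where
  "u @- v = (\<chi> i. case i of Inl a \<Rightarrow> u $ a | Inr b \<Rightarrow> v $ b)"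

definition vfst :: "'a^('m::finite + 'n::finite) \<Rightarrow> 'a^'m" where
  "vfst w = (\<chi> a. w $ Inl a)"

definition vsnd :: "'a^('m::finite + 'n::finite) \<Rightarrow> 'a^'n" where
  "vsnd w = (\<chi> b. w $ Inr b)"

definition hcat :: "'a^'m::finite^'r::finite \<Rightarrow> 'a^'n::finite^'r \<Rightarrow> 'a^('m + 'n)^'r"
    (infixr \<open>@|\<close> 63) where
  "A @| B = (\<chi> i. A $ i @- B $ i)"

definition null_space :: "real^'n::finite^'m::finite \<Rightarrow> (real^'n) set" where
  "null_space A = {v. A *v v = 0}"


section \<open>Second derivatives\<close>

definition gradient :: "(real^'n::finite \<Rightarrow> real) \<Rightarrow> real^'n \<Rightarrow> real^'n" where
  "gradient f x = (\<chi> i. frechet_derivative f (at x) (axis i 1))"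

definition hessian :: "(real^'n::finite \<Rightarrow> real) \<Rightarrow> real^'n \<Rightarrow> real^'n^'n" where
  "hessian f x = jacobian (gradient f) (at x)"

definition C2 :: "(real^'n::finite \<Rightarrow> real) \<Rightarrow> bool" where
  "C2 f \<longleftrightarrow> (\<forall>x. f differentiable (at x)) \<and> (\<forall>x. gradient f differentiable (at x)) \<and>
     continuous_on UNIV (hessian f)"


section \<open>Penalties and Lagrangian\<close>

definition least_squares :: "real^'n::finite \<Rightarrow> real" where
  "least_squares r = 1 / 2 * (norm r)\<^sup>2"

definition hybrid :: "real \<Rightarrow> real^'n::finite \<Rightarrow> real" where
  "hybrid \<nu> r = (\<Sum>i\<in>UNIV. sqrt ((r $ i)\<^sup>2 + \<nu>\<^sup>2) - \<nu>)"

definition least_squares_or_hybrid :: "(real^'n::finite \<Rightarrow> real) \<Rightarrow> bool" where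
  "least_squares_or_hybrid l \<longleftrightarrow> l = least_squares \<or> (\<exists>\<nu>>0. l = hybrid \<nu>)"

text \<open>
  \<open>y\<close> is the concatenation of \<open>x\<close>, \<open>r\<^sup>p\<close>, \<open>r\<^sup>m\<close>, \<open>\<lambda>\<^sup>p\<close>, \<open>\<lambda>\<^sup>m\<close>;
  \<open>Qh\<close> and \<open>Rh\<close> are the square roots of \<open>Q\<close> and \<open>R\<close>.
\<close>

definition lagrangian ::
  "(real^'n::finite \<Rightarrow> real) \<Rightarrow> (real^'m::finite \<Rightarrow> real) \<Rightarrow> real^'n^'n \<Rightarrow> real^'m^'m
     \<Rightarrow> ('t \<Rightarrow> real^'n^'n) \<Rightarrow> ('t \<Rightarrow> real^'n^'m) \<Rightarrow> real^'n \<Rightarrow> real^'m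
     \<Rightarrow> 't \<Rightarrow> real^('n + 'n + 'm + 'n + 'm) \<Rightarrow> real" where
  "lagrangian lp lm Qh Rh G H \<zeta> z \<theta> y =
     (let x = vfst y;
          rp = vfst (vsnd y);
          rm = vfst (vsnd (vsnd y));
          lamp = vfst (vsnd (vsnd (vsnd y)));
          lamm = vsnd (vsnd (vsnd (vsnd y)))
      in lp rp + lm rm
         - lamp \<bullet> (Qh *v rp - G \<theta> *v x + \<zeta>)
         - lamm \<bullet> (Rh *v rm - H \<theta> *v x + z))"

end

theory Submission
  imports Defs
begin

text \<open>
  The kernel of the second derivative is parametrised by its last component: the first three block
  rows and the invertibility of \<open>G\<close> and of the Hessians determine \<open>\<lambda>\<^sup>p\<close>, \<open>r\<^sup>p\<close>,
  \<open>r\<^sup>m\<close>, \<open>x\<close> from \<open>\<lambda>\<^sup>m\<close>, and the last row then says that \<open>S\<close> annihilates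
  \<open>\<lambda>\<^sup>m\<close>.  For the two penalties the Hessians are positive definite, so the quadratic form
  of \<open>S\<close> is a sum of two nonnegative terms, which vanish exactly on the null spaces of
  \<open>Q\<^sup>\<top>\<^sup>/\<^sup>2 G\<^sup>-\<^sup>\<top> H\<^sup>\<top>\<close> and \<open>R\<^sup>\<top>\<^sup>/\<^sup>2\<close>; these are those of
  \<open>Q G\<^sup>-\<^sup>\<top> H\<^sup>\<top>\<close> and \<open>R\<close>.
\<close>

section \<open>Block vectors and matrices\<close>

text \<open>The theory \<open>Matrix\<close> of \<open>Jordan_Normal_Form\<close> shadows \<open>vec_eq_iff\<close>.\<close>

lemmas cart_eq_iff = Finite_Cartesian_Product.vec_eq_iff

lemma vfst_vcat [simp]: "vfst (u @- v) = u"
  by (simp add: vfst_def vcat_def cart_eq_iff)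

lemma vsnd_vcat [simp]: "vsnd (u @- v) = v"
  by (simp add: vsnd_def vcat_def cart_eq_iff)

lemma vcat_vfst_vsnd [simp]: "vfst w @- vsnd w = w"
  by (simp add: vfst_def vsnd_def vcat_def cart_eq_iff split: sum.split)

lemma vcat_eq_iff [simp]: "u @- v = u' @- v' \<longleftrightarrow> u = u' \<and> v = v'"
  by (metis vfst_vcat vsnd_vcat)

lemma vcat_eq_0_iff [simp]:
  fixes u :: "'a::zero^'m::finite" and v :: "'a^'n::finite"
  shows "u @- v = 0 \<longleftrightarrow> u = 0 \<and> v = 0"
  by (auto simp: vcat_def cart_eq_iff split: sum.splits)

lemma inner_vcat:
  fixes u u' :: "real^'m::finite" and v v' :: "real^'n::finite"
  shows "(u @- v) \<bullet> (u' @- v') = u \<bullet> u' + v \<bullet> v'"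
  by (simp add: inner_vec_def vcat_def UNIV_Plus_UNIV [symmetric] sum.Plus
      del: UNIV_Plus_UNIV)

lemma vcat_matrix_vector_mult:
  fixes A :: "real^'c::finite^'m::finite" and B :: "real^'c^'n::finite"
  shows "(A @- B) *v w = (A *v w) @- (B *v w)"
  by (simp add: matrix_vector_mult_def vcat_def cart_eq_iff split: sum.split)

lemma hcat_matrix_vector_mult:
  fixes A :: "real^'m::finite^'r::finite" and B :: "real^'n::finite^'r"
  shows "(A @| B) *v (u @- v) = A *v u + B *v v"
  by (simp add: matrix_vector_mult_def hcat_def vcat_def cart_eq_iff
      UNIV_Plus_UNIV [symmetric] sum.Plus del: UNIV_Plus_UNIV)

section \<open>Differentiation of stacked vectors\<close>

lemma bounded_linear_vfst: "bounded_linear (vfst :: real^('m::finite + 'n::finite) \<Rightarrow> real^'m)"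
  by (simp add: linear_conv_bounded_linear [symmetric] linear_iff vfst_def cart_eq_iff)

lemma bounded_linear_vsnd: "bounded_linear (vsnd :: real^('m::finite + 'n::finite) \<Rightarrow> real^'n)"
  by (simp add: linear_conv_bounded_linear [symmetric] linear_iff vsnd_def cart_eq_iff)

text \<open>Stacking is phrased as a linear map on pairs so that the derivative rule for pairs
  carries over to \<open>@-\<close> by composition.\<close>

lemma bounded_linear_vcat:
  "bounded_linear (\<lambda>p. fst p @- snd p :: real^('m::finite + 'n::finite))"
  by (simp add: linear_conv_bounded_linear [symmetric] linear_iff vcat_def cart_eq_iff
      split: sum.split)

lemmas has_derivative_vfst [derivative_intros] =
  bounded_linear.has_derivative [OF bounded_linear_vfst]

lemmas has_derivative_vsnd [derivative_intros] =
  bounded_linear.has_derivative [OF bounded_linear_vsnd]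

lemma has_derivative_vcat [derivative_intros]:
  fixes f :: "'a::real_normed_vector \<Rightarrow> real^'m::finite" and g :: "'a \<Rightarrow> real^'n::finite"
  assumes "(f has_derivative f') (at x within s)" and "(g has_derivative g') (at x within s)"
  shows "((\<lambda>x. f x @- g x) has_derivative (\<lambda>h. f' h @- g' h)) (at x within s)"
  using bounded_linear.has_derivative [OF bounded_linear_vcat has_derivative_Pair [OF assms]]
  by simp

lemma has_derivative_matrix_vector_mult [derivative_intros]:
  fixes A :: "real^'n::finite^'m::finite"
  assumes "(f has_derivative f') F"
  shows "((\<lambda>x. A *v f x) has_derivative (\<lambda>h. A *v f' h)) F"
  using bounded_linear.has_derivative [OF matrix_vector_mul_bounded_linear assms] .

section \<open>Invertible matrices\<close>

text \<open>For a square matrix a left inverse is already an inverse. All invertibility claims below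
  are reduced to a trivial kernel in this way.\<close>

lemma invertible_iff_ker:
  fixes A :: "real^'n::finite^'n"
  shows "invertible A \<longleftrightarrow> (\<forall>x. A *v x = 0 \<longrightarrow> x = 0)"
  by (metis invertible_left_inverse matrix_left_invertible_ker)

lemma matrix_inv_mult:
  fixes A :: "real^'n::finite^'n"
  assumes "invertible A"
  shows "A ** matrix_inv A = mat 1" and "matrix_inv A ** A = mat 1"
  using assms matrix_inv_def [of A] someI_ex [of "\<lambda>B. A ** B = mat 1 \<and> B ** A = mat 1"]
  by (simp_all add: invertible_def)

lemma matrix_vector_mult_eq_iff:
  fixes A :: "real^'n::finite^'n"
  assumes "invertible A"
  shows "A *v x = y \<longleftrightarrow> x = matrix_inv A *v y"
  by (auto simp: matrix_vector_mul_assoc matrix_inv_mult [OF assms])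

lemma transpose_matrix_vector_mult_eq_iff:
  fixes A :: "real^'n::finite^'n"
  assumes "invertible A"
  shows "transpose A *v x = y \<longleftrightarrow> x = transpose (matrix_inv A) *v y"
  by (auto simp: matrix_vector_mul_assoc matrix_transpose_mul [symmetric] matrix_inv_mult [OF assms]
      transpose_mat simp del: transpose_matrix_vector)

lemma inner_matrix_vector_mult:
  fixes A :: "real^'n::finite^'m::finite"
  shows "u \<bullet> (A *v v) = (transpose A *v u) \<bullet> v"
  by (simp add: dot_lmul_matrix)

lemma uminus_matrix_vector_mult:
  fixes A :: "real^'n::finite^'m::finite"
  shows "(- A) *v v = - (A *v v)"
  by (simp add: matrix_vector_mult_def cart_eq_iff sum_negf)

text \<open>Pairing the left equation with \<open>v\<close> gives the squared norm of
  \<open>transpose A *v v\<close>. This is what later allows \<open>Q\<close> and \<open>R\<close>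
  to stand in for their transposed square roots in null spaces.\<close>

lemma gram_mult_eq_0_iff:
  fixes A :: "real^'n::finite^'m::finite"
  shows "A *v (transpose A *v v) = 0 \<longleftrightarrow> transpose A *v v = 0"
  by (metis inner_eq_zero_iff inner_matrix_vector_mult inner_zero_right matrix_vector_mult_0_right)

section \<open>Positive definite matrices and sums of congruences\<close>

definition positive_definite :: "real^'n::finite^'n \<Rightarrow> bool" where
  "positive_definite A \<longleftrightarrow> (\<forall>v. v \<noteq> 0 \<longrightarrow> 0 < v \<bullet> (A *v v))"

lemma positive_definite_imp_invertible:
  assumes "positive_definite A"
  shows "invertible A"
  unfolding invertible_iff_ker using assms
  by (metis inner_zero_right less_irrefl positive_definite_def)

text \<open>Substituting \<open>v = A *v u\<close> turns the quadratic form of the inverse at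
  \<open>v\<close> into that of \<open>A\<close> at \<open>u\<close>, and \<open>u\<close> is
  nonzero because \<open>v\<close> is.\<close>

lemma positive_definite_matrix_inv:
  assumes "positive_definite A"
  shows "positive_definite (matrix_inv A)"
  unfolding positive_definite_def
proof (intro allI impI)
  fix v :: "real^'a" assume "v \<noteq> 0"
  have eq: "A *v (matrix_inv A *v v) = v"
    using matrix_vector_mult_eq_iff [OF positive_definite_imp_invertible [OF assms]] by blast
  then have "matrix_inv A *v v \<noteq> 0"
    using \<open>v \<noteq> 0\<close> by (metis matrix_vector_mult_0_right)
  then show "0 < v \<bullet> (matrix_inv A *v v)"
    using assms eq unfolding positive_definite_def by (metis inner_commute)
qed

text \<open>The quadratic form of the sum at \<open>b\<close> is the form of \<open>P\<close> at
  \<open>transpose A *v b\<close> plus the form of \<open>M\<close> at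
  \<open>transpose B *v b\<close>. Both are nonnegative, so a kernel vector makes both arguments
  vanish, and the kernel is the intersection of the two null spaces.\<close>

lemma invertible_congruence_sum_iff:
  fixes A :: "real^'n::finite^'m::finite" and B :: "real^'k::finite^'m"
  assumes "positive_definite P" and "positive_definite M"
  shows "invertible (A ** P ** transpose A + B ** M ** transpose B) \<longleftrightarrow>
           null_space (transpose A) \<inter> null_space (transpose B) = {0}"
proof -
  let ?S = "A ** P ** transpose A + B ** M ** transpose B"
  have mult: "?S *v b = A *v (P *v (transpose A *v b)) + B *v (M *v (transpose B *v b))" for b
    by (simp add: matrix_vector_mult_add_rdistrib matrix_vector_mul_assoc matrix_mul_assoc
        del: transpose_matrix_vector)
  have form: "b \<bullet> (?S *v b) = (transpose A *v b) \<bullet> (P *v (transpose A *v b))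
      + (transpose B *v b) \<bullet> (M *v (transpose B *v b))" for b
    unfolding mult inner_add_right by (simp only: inner_matrix_vector_mult)
  have nonneg: "0 \<le> v \<bullet> (C *v v)" "v \<bullet> (C *v v) = 0 \<Longrightarrow> v = 0"
    if "positive_definite C" for C :: "real^'l::finite^'l" and v
    using that unfolding positive_definite_def by (cases "v = 0"; force)+
  have "?S *v b = 0 \<longleftrightarrow> transpose A *v b = 0 \<and> transpose B *v b = 0" for b
  proof
    assume "?S *v b = 0"
    then have "b \<bullet> (?S *v b) = 0"
      by simp
    then show "transpose A *v b = 0 \<and> transpose B *v b = 0"
      unfolding form using nonneg assms by (metis add_nonneg_eq_0_iff)
  qed (simp add: mult del: transpose_matrix_vector)
  then show ?thesis
    unfolding invertible_iff_ker null_space_def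
    by (auto simp: matrix_vector_mult_0_right simp del: transpose_matrix_vector)
qed

text \<open>Forward substitution: once the earlier blocks of a kernel vector are zero, a block row
  reduces to its identity block. The induction runs over the time step of a coordinate.\<close>

lemma invertible_block_bidiag:
  assumes "block_index N n ix"
  shows "invertible (block_bidiag ix n G)"
  unfolding invertible_iff_ker
proof (intro allI impI)
  fix v assume ker: "block_bidiag ix n G *v v = 0"
  have inj: "inj ix" and range: "snd (ix a) < n (fst (ix a))" for a
    using assms bij_betw_apply [of ix UNIV _ a]
    by (auto simp: block_index_def bij_betw_def)
  have "v $ a = 0" for a
  proof (induction "fst (ix a)" arbitrary: a rule: less_induct)
    case less
    have "block_bidiag ix n G $ a $ b * v $ b = (if b = a then v $ a else 0)" for b
    \<comment> \<open>Earlier columns, including the subdiagonal block, contribute nothing by the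
      induction hypothesis. The other columns meet only identity or zero blocks, whose entries can
      be evaluated because \<open>range\<close> keeps the positions inside the block sizes.\<close>
    proof (cases "fst (ix b) < fst (ix a)")
      case True
      then show ?thesis using less by auto
    next
      case False
      then show ?thesis
        using range [of a] range [of b] injD [OF inj, of a b]
        by (auto simp: block_bidiag_def stack_mat_def split_beta prod_eq_iff)
    qed
    then have "(block_bidiag ix n G *v v) $ a = v $ a"
      by (simp add: matrix_vector_mult_def)
    then show ?case using ker by simp
  qed
  then show "v = 0" by (simp add: cart_eq_iff)
qed

section \<open>Hessians\<close>

lemma gradient_eqI:
  assumes "(f has_derivative (\<lambda>h. g \<bullet> h)) (at x)"
  shows "gradient f x = g"
  using frechet_derivative_at [OF assms, symmetric]
  by (simp add: gradient_def cart_eq_iff inner_axis)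

text \<open>By uniqueness of derivatives a guessed gradient field \<open>g\<close> can be verified
  and then differentiated. It must be the gradient everywhere, although its own derivative is needed
  only at \<open>x\<close>.\<close>

lemma hessian_eqI:
  assumes "\<And>x. (f has_derivative (\<lambda>h. g x \<bullet> h)) (at x)"
    and "(g has_derivative (\<lambda>h. A *v h)) (at x)"
  shows "hessian f x = A"
proof -
  have "gradient f = g"
    using assms(1) gradient_eqI by blast
  then show ?thesis
    using frechet_derivative_at [OF assms(2), symmetric]
    by (simp add: hessian_def jacobian_def)
qed

lemma C2_has_derivative:
  assumes "C2 f"
  shows "(f has_derivative (\<lambda>h. gradient f x \<bullet> h)) (at x)"
    and "(gradient f has_derivative (\<lambda>h. hessian f x *v h)) (at x)"
proof -
  have f: "(f has_derivative frechet_derivative f (at x)) (at x)"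
    using assms by (simp add: C2_def frechet_derivative_works [symmetric])
  then have lin: "linear (frechet_derivative f (at x))"
    by (rule has_derivative_linear)
  have "frechet_derivative f (at x) h = gradient f x \<bullet> h" for h
  proof -
    \<comment> \<open>The gradient records the derivative on axis vectors only, so \<open>h\<close>
      is expanded in the standard basis and linearity does the rest.\<close>
    have "frechet_derivative f (at x) h =
        frechet_derivative f (at x) (\<Sum>i\<in>UNIV. h $ i *\<^sub>R axis i 1)"
      using basis_expansion [of h] by (simp add: scalar_mult_eq_scaleR)
    also have "\<dots> = gradient f x \<bullet> h"
      by (simp add: linear_sum [OF lin] linear_scale [OF lin] gradient_def inner_vec_def mult.commute)
    finally show ?thesis .
  qed
  then show "(f has_derivative (\<lambda>h. gradient f x \<bullet> h)) (at x)"
    using f by presburger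
  show "(gradient f has_derivative (\<lambda>h. hessian f x *v h)) (at x)"
    using assms by (simp add: C2_def hessian_def jacobian_works [symmetric])
qed

section \<open>Hessians of the two penalties\<close>

lemma hessian_least_squares: "hessian least_squares r = mat 1"
proof (rule hessian_eqI [where g = "\<lambda>r. r"])
  fix x :: "real^'n"
  have eq: "least_squares = (\<lambda>r::real^'n. 1 / 2 * (r \<bullet> r))"
    by (simp add: fun_eq_iff least_squares_def power2_norm_eq_inner)
  show "(least_squares has_derivative (\<lambda>h. x \<bullet> h)) (at x)"
    unfolding eq by (auto intro!: derivative_eq_intros simp: inner_commute)
qed simp

text \<open>The penalty is a sum of one-variable functions of separate coordinates, so the Hessian
  is diagonal and only two scalar derivatives have to be computed.\<close>

lemma hessian_hybrid:
  assumes "\<nu> > 0"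
  shows "hessian (hybrid \<nu>) r =
    (\<chi> i j. if i = j then \<nu>\<^sup>2 / (sqrt ((r $ i)\<^sup>2 + \<nu>\<^sup>2))^3 else 0)"
proof (rule hessian_eqI [where g = "\<lambda>r. \<chi> i. r $ i / sqrt ((r $ i)\<^sup>2 + \<nu>\<^sup>2)"])
  have pos: "t\<^sup>2 + \<nu>\<^sup>2 > 0" for t :: real
    using assms by (simp add: add_nonneg_pos)
  have d0: "((\<lambda>t. sqrt (t\<^sup>2 + \<nu>\<^sup>2)) has_real_derivative t / sqrt (t\<^sup>2 + \<nu>\<^sup>2)) (at t)" for t
    using pos [of t] by (auto intro!: derivative_eq_intros simp: field_simps)
  have d1: "((\<lambda>t. sqrt (t\<^sup>2 + \<nu>\<^sup>2) - \<nu>) has_real_derivative t / sqrt (t\<^sup>2 + \<nu>\<^sup>2)) (at t)" for t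
    using DERIV_diff [OF d0 DERIV_const] by simp
  have d2: "((\<lambda>t. t / sqrt (t\<^sup>2 + \<nu>\<^sup>2)) has_real_derivative
      \<nu>\<^sup>2 / (sqrt (t\<^sup>2 + \<nu>\<^sup>2))^3) (at t)" for t
  proof -
    \<comment> \<open>With \<open>s\<close> for the root, the quotient rule yields a rational
      expression in \<open>s\<close> and \<open>t\<close>; replacing \<open>\<nu>\<^sup>2\<close> by
      \<open>s\<^sup>2 - t\<^sup>2\<close> makes the required equality a polynomial identity after
      clearing denominators.\<close>
    define s where "s = sqrt (t\<^sup>2 + \<nu>\<^sup>2)"
    have s: "s > 0" and \<nu>: "\<nu>\<^sup>2 = s\<^sup>2 - t\<^sup>2"
      using pos [of t] by (auto simp: s_def)
    have eq: "(1 * s - t * (t / s)) / (s * s) = \<nu>\<^sup>2 / s^3"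
      unfolding \<nu> using s by (simp add: field_simps power2_eq_square power3_eq_cube)
    have "((\<lambda>t. t / sqrt (t\<^sup>2 + \<nu>\<^sup>2)) has_real_derivative
        (1 * s - t * (t / s)) / (s * s)) (at t)"
      using s unfolding s_def by (intro DERIV_divide DERIV_ident d0) linarith
    then show ?thesis
      unfolding eq unfolding s_def .
  qed
  note nth = bounded_linear_imp_has_derivative [OF bounded_linear_vec_nth]
  show "(hybrid \<nu> has_derivative (\<lambda>h. (\<chi> i. x $ i / sqrt ((x $ i)\<^sup>2 + \<nu>\<^sup>2)) \<bullet> h)) (at x)"
    for x :: "real^'n"
    unfolding hybrid_def [abs_def] inner_vec_def
    using has_derivative_compose [OF nth has_field_derivative_imp_has_derivative [OF d1]]
    by (auto intro!: has_derivative_sum)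
  have "((\<lambda>x. x $ i / sqrt ((x $ i)\<^sup>2 + \<nu>\<^sup>2)) has_derivative
      (\<lambda>h. \<nu>\<^sup>2 / (sqrt ((r $ i)\<^sup>2 + \<nu>\<^sup>2))^3 * h $ i)) (at r)" for i
    by (rule has_derivative_compose [OF nth has_field_derivative_imp_has_derivative [OF d2]])
  then show "((\<lambda>x. \<chi> i. x $ i / sqrt ((x $ i)\<^sup>2 + \<nu>\<^sup>2)) has_derivative
      (*v) (\<chi> i j. if i = j then \<nu>\<^sup>2 / (sqrt ((r $ i)\<^sup>2 + \<nu>\<^sup>2))^3 else 0)) (at r)"
    by (subst has_derivative_componentwise_within)
      (simp add: Basis_vec_def inner_axis matrix_vector_mult_def if_distrib if_distribR
        cong: if_cong)
qed

text \<open>Either the identity matrix or a diagonal matrix whose entries are positive because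
  \<open>\<nu>\<close> is.\<close>

lemma positive_definite_hessian:
  assumes "least_squares_or_hybrid l"
  shows "positive_definite (hessian l r)"
  using assms unfolding least_squares_or_hybrid_def
proof (elim disjE exE conjE)
  assume "l = least_squares"
  then show ?thesis
    by (simp add: hessian_least_squares positive_definite_def)
next
  fix \<nu> :: real assume \<nu>: "\<nu> > 0" "l = hybrid \<nu>"
  define d where "d i = \<nu>\<^sup>2 / (sqrt ((r $ i)\<^sup>2 + \<nu>\<^sup>2))^3" for i
  have d: "d i > 0" for i
    using \<nu> by (simp add: d_def add_nonneg_pos)
  have form: "v \<bullet> (hessian l r *v v) = (\<Sum>i\<in>UNIV. d i * (v $ i)\<^sup>2)" for v
    unfolding \<nu>(2) hessian_hybrid [OF \<nu>(1)] d_def [symmetric]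
    by (simp add: inner_vec_def matrix_vector_mult_def if_distrib if_distribR
        power2_eq_square mult_ac cong: if_cong)
  show ?thesis
    unfolding positive_definite_def form
  proof (intro allI impI)
    fix v :: "real^'a" assume "v \<noteq> 0"
    then obtain i where "v $ i \<noteq> 0" by (auto simp: cart_eq_iff)
    then show "0 < (\<Sum>i\<in>UNIV. d i * (v $ i)\<^sup>2)"
      using d by (intro sum_pos2 [of UNIV i]) (auto simp: less_imp_le)
  qed
qed

section \<open>The saddle point matrix\<close>

text \<open>\<open>P\<close> and \<open>M\<close> take the places of the two loss Hessians, so that
  block elimination can be carried out without reference to the losses.\<close>

definition kkt_matrix ::
  "real^'n::finite^'n \<Rightarrow> real^'n^'m::finite \<Rightarrow> real^'n^'n \<Rightarrow> real^'m^'m \<Rightarrow> real^'n^'n \<Rightarrow> real^'m^'m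
     \<Rightarrow> real^('n + 'n + 'm + 'n + 'm)^('n + 'n + 'm + 'n + 'm)" where
  "kkt_matrix G H Qh Rh P M =
     (0 @| 0    @| 0    @| transpose G    @| transpose H) @-
     (0 @| P    @| 0    @| - transpose Qh @| 0) @-
     (0 @| 0    @| M    @| 0              @| - transpose Rh) @-
     (G @| - Qh @| 0    @| 0              @| 0) @-
     (H @| 0    @| - Rh @| 0              @| 0)"

lemma kkt_matrix_mult_vector:
  "kkt_matrix G H Qh Rh P M *v (u @- v @- w @- a @- b) =
     (transpose G *v a + transpose H *v b) @-
     (P *v v - transpose Qh *v a) @-
     (M *v w - transpose Rh *v b) @-
     (G *v u - Qh *v v) @-
     (H *v u - Rh *v w)"
  by (simp add: kkt_matrix_def vcat_matrix_vector_mult hcat_matrix_vector_mult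
      uminus_matrix_vector_mult del: transpose_matrix_vector)

lemma hessian_lagrangian:
  fixes \<zeta> :: "real^'n::finite" and z :: "real^'m::finite"
  assumes "C2 lp" and "C2 lm"
  shows "hessian (lagrangian lp lm Qh Rh G H \<zeta> z \<theta>) (x @- rp @- rm @- lamp @- lamm) =
    kkt_matrix (G \<theta>) (H \<theta>) Qh Rh (hessian lp rp) (hessian lm rm)"
proof -
  \<comment> \<open>The five projections get names so that each is its own derivative and the rules
    treat it as a unit.\<close>
  define X :: "real^('n + 'n + 'm + 'n + 'm) \<Rightarrow> real^'n" where "X y = vfst y" for y
  define RP :: "real^('n + 'n + 'm + 'n + 'm) \<Rightarrow> real^'n" where "RP y = vfst (vsnd y)" for y
  define RM :: "real^('n + 'n + 'm + 'n + 'm) \<Rightarrow> real^'m" where "RM y = vfst (vsnd (vsnd y))" for y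
  define LP :: "real^('n + 'n + 'm + 'n + 'm) \<Rightarrow> real^'n"
    where "LP y = vfst (vsnd (vsnd (vsnd y)))" for y
  define LM :: "real^('n + 'n + 'm + 'n + 'm) \<Rightarrow> real^'m"
    where "LM y = vsnd (vsnd (vsnd (vsnd y)))" for y
  have split: "y = X y @- RP y @- RM y @- LP y @- LM y" for y
    by (simp add: X_def RP_def RM_def LP_def LM_def)
  have projs: "X (x @- rp @- rm @- lamp @- lamm) = x" "RP (x @- rp @- rm @- lamp @- lamm) = rp"
    "RM (x @- rp @- rm @- lamp @- lamm) = rm" "LP (x @- rp @- rm @- lamp @- lamm) = lamp"
    "LM (x @- rp @- rm @- lamp @- lamm) = lamm" for x rp rm lamp lamm
    by (simp_all add: X_def RP_def RM_def LP_def LM_def)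
  have D: "(X has_derivative X) (at y)" "(RP has_derivative RP) (at y)"
    "(RM has_derivative RM) (at y)" "(LP has_derivative LP) (at y)"
    "(LM has_derivative LM) (at y)" for y
    unfolding X_def RP_def RM_def LP_def LM_def
    by (auto intro!: derivative_intros)
  note [derivative_intros] = D
  note lp = has_derivative_compose [OF D(2) C2_has_derivative(1) [OF assms(1)]]
    and lp' = has_derivative_compose [OF D(2) C2_has_derivative(2) [OF assms(1)]]
    and lm = has_derivative_compose [OF D(3) C2_has_derivative(1) [OF assms(2)]]
    and lm' = has_derivative_compose [OF D(3) C2_has_derivative(2) [OF assms(2)]]
  let ?G = "G \<theta>" and ?H = "H \<theta>"
  \<comment> \<open>The candidate gradient: its blocks are the partial gradients in
    \<open>x\<close>, \<open>rp\<close>, \<open>rm\<close>, \<open>lamp\<close>,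
    \<open>lamm\<close>. The last two are the negated constraint residuals.\<close>
  define g where "g y = (transpose ?G *v LP y + transpose ?H *v LM y) @-
     (gradient lp (RP y) - transpose Qh *v LP y) @-
     (gradient lm (RM y) - transpose Rh *v LM y) @-
     (?G *v X y - Qh *v RP y - \<zeta>) @-
     (?H *v X y - Rh *v RM y - z)" for y
  have L: "lagrangian lp lm Qh Rh G H \<zeta> z \<theta> = (\<lambda>y. lp (RP y) + lm (RM y)
      - LP y \<bullet> (Qh *v RP y - ?G *v X y + \<zeta>) - LM y \<bullet> (Rh *v RM y - ?H *v X y + z))"
    by (simp add: fun_eq_iff lagrangian_def Let_def X_def RP_def RM_def LP_def LM_def)
  show ?thesis
  proof (rule hessian_eqI [where g = g])
    fix y
    \<comment> \<open>Moving the matrices across the inner product brings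
      \<open>g y \<bullet> h\<close> into the form that the product rule produces for the
      Lagrangian.\<close>
    have "g y \<bullet> h = gradient lp (RP y) \<bullet> RP h + gradient lm (RM y) \<bullet> RM h
      - (LP y \<bullet> (Qh *v RP h - ?G *v X h) + LP h \<bullet> (Qh *v RP y - ?G *v X y + \<zeta>))
      - (LM y \<bullet> (Rh *v RM h - ?H *v X h) + LM h \<bullet> (Rh *v RM y - ?H *v X y + z))" for h
      unfolding g_def
      by (subst split [of h])
        (simp add: inner_vcat inner_matrix_vector_mult inner_diff_left inner_diff_right
          inner_add_left inner_add_right inner_commute [of _ "LP h"] inner_commute [of _ "LM h"]
          del: transpose_matrix_vector)
    then show "(lagrangian lp lm Qh Rh G H \<zeta> z \<theta> has_derivative (\<lambda>h. g y \<bullet> h)) (at y)"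
      unfolding L by (auto intro!: derivative_eq_intros lp lm)
  next
    let ?y = "x @- rp @- rm @- lamp @- lamm"
    \<comment> \<open>The terms \<open>- 0\<close> are the derivatives of the constants
      \<open>\<zeta>\<close> and \<open>z\<close>; keeping them makes the right-hand side match the
      derivative of \<open>g\<close> literally.\<close>
    have K: "kkt_matrix ?G ?H Qh Rh (hessian lp rp) (hessian lm rm) *v h =
       (transpose ?G *v LP h + transpose ?H *v LM h) @-
       (hessian lp (RP ?y) *v RP h - transpose Qh *v LP h) @-
       (hessian lm (RM ?y) *v RM h - transpose Rh *v LM h) @-
       (?G *v X h - Qh *v RP h - 0) @-
       (?H *v X h - Rh *v RM h - 0)" for h
      by (subst split [of h]) (simp add: kkt_matrix_mult_vector projs del: transpose_matrix_vector)
    show "(g has_derivative (*v) (kkt_matrix ?G ?H Qh Rh (hessian lp rp) (hessian lm rm))) (at ?y)"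
      unfolding g_def [abs_def] K [abs_def]
      by (intro derivative_intros lp' lm' D)
  qed
qed

text \<open>Block elimination, with \<open>- S\<close> as the Schur complement left in the last
  block row once the other four unknowns are eliminated.\<close>

lemma invertible_kkt_matrix_iff:
  fixes G P Qh :: "real^'n::finite^'n" and M Rh :: "real^'m::finite^'m" and H :: "real^'n^'m"
  assumes G: "invertible G" and P: "invertible P" and M: "invertible M"
  defines "S \<equiv> H ** matrix_inv G ** Qh ** matrix_inv P ** transpose Qh
                  ** transpose (matrix_inv G) ** transpose H
              + Rh ** matrix_inv M ** transpose Rh"
  shows "invertible (kkt_matrix G H Qh Rh P M) \<longleftrightarrow> invertible S"
proof -
  let ?K = "kkt_matrix G H Qh Rh P M"
  \<comment> \<open>These solve block rows one to four in turn: \<open>a\<close> from the first,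
    \<open>v\<close> from the second, \<open>w\<close> from the third, \<open>u\<close> from the
    fourth. Each depends only on \<open>b\<close>.\<close>
  define a where "a b = - (transpose (matrix_inv G) *v (transpose H *v b))" for b
  define v where "v b = matrix_inv P *v (transpose Qh *v a b)" for b
  define w where "w b = matrix_inv M *v (transpose Rh *v b)" for b
  define u where "u b = matrix_inv G *v (Qh *v v b)" for b
  have S: "H *v u b - Rh *v w b = - (S *v b)" for b
    unfolding S_def u_def v_def w_def a_def
    by (simp add: matrix_vector_mult_add_rdistrib matrix_vector_mul_assoc [symmetric]
        linear_neg [OF matrix_vector_mul_linear]
        del: transpose_matrix_vector)
  have ker: "?K *v (u' @- v' @- w' @- a' @- b) = 0 \<longleftrightarrow>
      a' = a b \<and> v' = v b \<and> w' = w b \<and> u' = u b \<and> S *v b = 0" for u' v' w' a' b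
  proof -
    have "transpose G *v a' + transpose H *v b = 0 \<longleftrightarrow> a' = a b"
      unfolding a_def add_eq_0_iff2 transpose_matrix_vector_mult_eq_iff [OF G]
      by (simp only: linear_neg [OF matrix_vector_mul_linear])
    moreover have "P *v v' - transpose Qh *v a b = 0 \<longleftrightarrow> v' = v b"
      unfolding v_def right_minus_eq matrix_vector_mult_eq_iff [OF P] ..
    moreover have "M *v w' - transpose Rh *v b = 0 \<longleftrightarrow> w' = w b"
      unfolding w_def right_minus_eq matrix_vector_mult_eq_iff [OF M] ..
    moreover have "G *v u' - Qh *v v b = 0 \<longleftrightarrow> u' = u b"
      unfolding u_def right_minus_eq matrix_vector_mult_eq_iff [OF G] ..
    moreover have "H *v u b - Rh *v w b = 0 \<longleftrightarrow> S *v b = 0"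
      unfolding S by simp
    ultimately show ?thesis
      unfolding kkt_matrix_mult_vector vcat_eq_0_iff by blast
  qed
  show ?thesis
    unfolding invertible_iff_ker
  proof safe
    \<comment> \<open>A kernel vector \<open>b\<close> of \<open>S\<close> extends to a kernel
      vector of the block matrix with last component \<open>b\<close>.\<close>
    fix b assume "\<forall>y. ?K *v y = 0 \<longrightarrow> y = 0" "S *v b = 0"
    then show "b = 0" using ker [of "u b" "v b" "w b" "a b" b] by auto
  next
    fix y assume S0: "\<forall>b. S *v b = 0 \<longrightarrow> b = 0" and K0: "?K *v y = 0"
    obtain u' v' w' a' b where y: "y = u' @- v' @- w' @- a' @- b"
      using vcat_vfst_vsnd [of y, symmetric] vcat_vfst_vsnd [of "vsnd y", symmetric]
        vcat_vfst_vsnd [of "vsnd (vsnd y)", symmetric]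
        vcat_vfst_vsnd [of "vsnd (vsnd (vsnd y))", symmetric] by metis
    then have "a' = a b" "v' = v b" "w' = w b" "u' = u b" "b = 0"
      using K0 S0 ker by auto
    then show "y = 0"
      by (simp add: y a_def u_def v_def w_def del: transpose_matrix_vector)
  qed
qed

section \<open>The two equivalences for the smoothing problem\<close>

theorem theorem2:
  fixes N :: nat and n m :: "nat \<Rightarrow> nat"
    and ixn :: "'n::finite \<Rightarrow> nat \<times> nat" and ixm :: "'m::finite \<Rightarrow> nat \<times> nat"
    and Gk Hk :: "nat \<Rightarrow> real^'p::finite \<Rightarrow> real Matrix.mat"
    and Qk Rk :: "nat \<Rightarrow> real Matrix.mat"
    and x\<^sub>0 :: "real Matrix.vec" and zk :: "nat \<Rightarrow> real Matrix.vec"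
    and Qh :: "real^'n^'n" and Rh :: "real^'m^'m"
    and lp :: "real^'n \<Rightarrow> real" and lm :: "real^'m \<Rightarrow> real"
    and \<theta> :: "real^'p" and x rp lamp :: "real^'n" and rm lamm :: "real^'m"
  defines "G \<equiv> \<lambda>t. block_bidiag ixn n (\<lambda>k. Gk k t)"
    and "H \<equiv> \<lambda>t. block_diag ixm ixn (\<lambda>k. Hk k t)"
    and "Q \<equiv> block_diag ixn ixn Qk"
    and "R \<equiv> block_diag ixm ixm Rk"
    and "\<zeta> \<equiv> stack_vec ixn (\<lambda>k. if k = 1 then x\<^sub>0 else 0\<^sub>v (n k))"
    and "z \<equiv> stack_vec ixm zk"
  defines "f \<equiv> lagrangian lp lm Qh Rh G H \<zeta> z"
    and "y \<equiv> x @- rp @- rm @- lamp @- lamm"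
  defines "S \<equiv> H \<theta> ** matrix_inv (G \<theta>) ** Qh ** matrix_inv (hessian lp rp) ** transpose Qh
                  ** transpose (matrix_inv (G \<theta>)) ** transpose (H \<theta>)
              + Rh ** matrix_inv (hessian lm rm) ** transpose Rh"
  assumes "block_index N n ixn" and "block_index N m ixm"
    and "n 0 = n 1"
    and "\<And>k t. k \<in> {1..N} \<Longrightarrow> Gk k t \<in> carrier_mat (n k) (n (k - 1))"
    and "\<And>k t. k \<in> {1..N} \<Longrightarrow> Hk k t \<in> carrier_mat (m k) (n k)"
    and "\<And>k i j. k \<in> {1..N} \<Longrightarrow> i < n k \<Longrightarrow> j < n (k - 1) \<Longrightarrow> C2 (\<lambda>t. Gk k t $$ (i, j))"
    and "\<And>k i j. k \<in> {1..N} \<Longrightarrow> i < m k \<Longrightarrow> j < n k \<Longrightarrow> C2 (\<lambda>t. Hk k t $$ (i, j))"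
    and "\<And>k. k \<in> {1..N} \<Longrightarrow> sym_psd (n k) (Qk k)"
    and "\<And>k. k \<in> {1..N} \<Longrightarrow> sym_psd (m k) (Rk k)"
    and "x\<^sub>0 \<in> carrier_vec (n 0)"
    and "\<And>k. k \<in> {1..N} \<Longrightarrow> zk k \<in> carrier_vec (m k)"
    and "Qh ** transpose Qh = Q" and "Rh ** transpose Rh = R"
    and "C2 lp" and "C2 lm"
  shows
    "hessian (f \<theta>) y =
       (0    @| 0             @| 0             @| transpose (G \<theta>) @| transpose (H \<theta>)) @-
       (0    @| hessian lp rp @| 0             @| - transpose Qh   @| 0) @-
       (0    @| 0             @| hessian lm rm @| 0                @| - transpose Rh) @-
       (G \<theta>  @| - Qh          @| 0             @| 0                @| 0) @-
       (H \<theta>  @| 0             @| - Rh          @| 0                @| 0)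
     \<and> (invertible (hessian lp rp) \<and> invertible (hessian lm rm)
          \<longrightarrow> (invertible (hessian (f \<theta>) y) \<longleftrightarrow> invertible S))
     \<and> (least_squares_or_hybrid lp \<and> least_squares_or_hybrid lm
          \<longrightarrow> (invertible S \<longleftrightarrow>
                null_space R \<inter> null_space (Q ** transpose (matrix_inv (G \<theta>)) ** transpose (H \<theta>))
                  = {0}))"
proof -
  have G: "invertible (G \<theta>)"
    unfolding G_def using assms by (intro invertible_block_bidiag)
  have hess: "hessian (f \<theta>) y =
      kkt_matrix (G \<theta>) (H \<theta>) Qh Rh (hessian lp rp) (hessian lm rm)"
    unfolding f_def y_def using \<open>C2 lp\<close> \<open>C2 lm\<close> by (rule hessian_lagrangian)
  have "invertible S \<longleftrightarrow>
      null_space R \<inter> null_space (Q ** transpose (matrix_inv (G \<theta>)) ** transpose (H \<theta>)) = {0}"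
    if "least_squares_or_hybrid lp" "least_squares_or_hybrid lm"
  proof -
    \<comment> \<open>This factor exhibits \<open>S\<close> as a sum of two congruences, of the
      inverse Hessians by \<open>?A\<close> and by \<open>Rh\<close>.\<close>
    let ?A = "H \<theta> ** matrix_inv (G \<theta>) ** Qh"
    have A: "transpose ?A = transpose Qh ** transpose (matrix_inv (G \<theta>)) ** transpose (H \<theta>)"
      by (simp add: matrix_transpose_mul matrix_mul_assoc)
    have S: "S = ?A ** matrix_inv (hessian lp rp) ** transpose ?A
        + Rh ** matrix_inv (hessian lm rm) ** transpose Rh"
      unfolding S_def A by (simp add: matrix_mul_assoc)
    \<comment> \<open>Left multiplication by \<open>Qh\<close> leaves the null space unchanged, by
      the Gram identity, and completes \<open>transpose Qh\<close> to \<open>Q\<close>.\<close>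
    have "null_space (transpose ?A) =
        null_space (Q ** transpose (matrix_inv (G \<theta>)) ** transpose (H \<theta>))"
      unfolding A null_space_def \<open>Qh ** transpose Qh = Q\<close> [symmetric]
        matrix_vector_mul_assoc [symmetric] gram_mult_eq_0_iff ..
    moreover have "null_space (transpose Rh) = null_space R"
      unfolding null_space_def \<open>Rh ** transpose Rh = R\<close> [symmetric]
        matrix_vector_mul_assoc [symmetric] gram_mult_eq_0_iff ..
    ultimately show ?thesis
      unfolding S using invertible_congruence_sum_iff positive_definite_matrix_inv
        positive_definite_hessian that by (metis inf_commute)
  qed
  then show ?thesis
    using invertible_kkt_matrix_iff [OF G, of "hessian lp rp" "hessian lm rm" "H \<theta>" Qh Rh]
    unfolding hess S_def kkt_matrix_def by blast
qed

end
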